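(* Let $A$ be a $*$-algebra over $K$ and let $\mu_1,\mu_2\in K\setminus\{0\}$. A map $\phi\colon\mathrm{Cay}(A,\mu_1)\to \mathrm{Cay}(A,\mu_2)$ is an $A$-isomorphism if and only if it is of the form $$\phi(x,y)=(x+cy^*,\,dy)\qquad (x,y\in A),$$ for some $c,d\in A$ satisfying all of the following: 1. $c\in N(A)$ and $c$ is a skew $*$-element; 2. $d\in N_l(A)$ and the map $A\to A$, $x\mapsto dx$, is bijective; 3. $\mu_1 xy=c^2(xy)+\mu_2(xd^* )(dy)$ for all $x,y\in A$.
   Context: All rings and algebras are unital. $K$ is a commutative associative ring; an algebra $A$ over $K$ is not assumed commutative or associative. An involution of $A$ is a $K$-linear map $x\mapsto x^*$ with $(x^* )^*=x$ and $(xy)^*=y^*x^*$ for all $x,y\in A$; a $*$-algebra is an algebra equipped with an involution. For a $*$-algebra $A$ and $\mu\in K\setminus\{0\}$, the Cayley double $\mathrm{Cay}(A,\mu)$ is the $K$-algebra with underlying module $A\oplus A$ and multiplication $(u,v)(x,y)=(ux+\mu y^*v,\ vx^*+yu)$. An $A$-isomorphism $\phi\colon\mathrm{Cay}(A,\mu_1)\to \mathrm{Cay}(A,\mu_2)$ is a $K$-algebra isomorphism that extends the identity automorphism of $A$, i.e. $\phi(x,0)=(x,0)$ for all $x\in A$. The associator is $(x,y,z)=(xy)z-x(yz)$. The left nucleus is $N_l(A)=\{x\in A\mid (x,y,z)=0\ \forall y,z\in A\}$, the middle nucleus is $N_m(A)=\{y\in A\mid (x,y,z)=0\ \forall x,z\in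 A\}$, the right nucleus is $N_r(A)=\{z\in A\mid (x,y,z)=0\ \forall x,y\in A\}$, and the nucleus is $N(A)=N_l(A)\cap N_m(A)\cap N_r(A)$. An element $a\in A$ is skew if $a^*=-a$; it is a $*$-element if $ax=x^*a$ for all $x\in A$; a skew $*$-element is an element that is both. *)

theory Defs
  imports "HOL-Analysis.Product_Vector"
begin

text \<open>
  The type classes for rings all include associativity, so algebras that need not be associative
  are given by explicit operations on an additive group, over the library's \<open>module\<close> locale.
  The zero algebra is not excluded.
\<close>

locale nonassoc_algebra = module smul
  for smul :: "'k::comm_ring_1 \<Rightarrow> 'a::ab_group_add \<Rightarrow> 'a" (infixr "*s" 75) +
  fixes mult :: "'a \<Rightarrow> 'a \<Rightarrow> 'a" (infixl "\<odot>" 70)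
    and one :: 'a ("\<one>")
  assumes mult_add_left: "(x + y) \<odot> z = x \<odot> z + y \<odot> z"
    and mult_add_right: "x \<odot> (y + z) = x \<odot> y + x \<odot> z"
    and mult_scale_left: "(r *s x) \<odot> y = r *s (x \<odot> y)"
    and mult_scale_right: "x \<odot> (r *s y) = r *s (x \<odot> y)"
    and mult_one_left: "\<one> \<odot> x = x"
    and mult_one_right: "x \<odot> \<one> = x"

locale star_algebra = nonassoc_algebra smul mult one + star: module_hom smul smul star
  for smul :: "'k::comm_ring_1 \<Rightarrow> 'a::ab_group_add \<Rightarrow> 'a" (infixr "*s" 75)
    and mult :: "'a \<Rightarrow> 'a \<Rightarrow> 'a" (infixl "\<odot>" 70)
    and one :: 'a ("\<one>")
    and star :: "'a \<Rightarrow> 'a" +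
  assumes star_star: "star (star x) = x"
    and star_mult: "star (x \<odot> y) = star y \<odot> star x"

definition associator :: "('a::ab_group_add \<Rightarrow> 'a \<Rightarrow> 'a) \<Rightarrow> 'a \<Rightarrow> 'a \<Rightarrow> 'a \<Rightarrow> 'a" where
  "associator mult x y z = mult (mult x y) z - mult x (mult y z)"

definition left_nucleus :: "('a::ab_group_add \<Rightarrow> 'a \<Rightarrow> 'a) \<Rightarrow> 'a set" where
  "left_nucleus mult = {x. \<forall>y z. associator mult x y z = 0}"

definition middle_nucleus :: "('a::ab_group_add \<Rightarrow> 'a \<Rightarrow> 'a) \<Rightarrow> 'a set" where
  "middle_nucleus mult = {y. \<forall>x z. associator mult x y z = 0}"

definition right_nucleus :: "('a::ab_group_add \<Rightarrow> 'a \<Rightarrow> 'a) \<Rightarrow> 'a set" where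
  "right_nucleus mult = {z. \<forall>x y. associator mult x y z = 0}"

definition nucleus :: "('a::ab_group_add \<Rightarrow> 'a \<Rightarrow> 'a) \<Rightarrow> 'a set" where
  "nucleus mult = left_nucleus mult \<inter> middle_nucleus mult \<inter> right_nucleus mult"

definition skew :: "('a::ab_group_add \<Rightarrow> 'a) \<Rightarrow> 'a \<Rightarrow> bool" where
  "skew star a \<longleftrightarrow> star a = - a"

definition star_element :: "('a \<Rightarrow> 'a \<Rightarrow> 'a) \<Rightarrow> ('a \<Rightarrow> 'a) \<Rightarrow> 'a \<Rightarrow> bool" where
  "star_element mult star a \<longleftrightarrow> (\<forall>x. mult a x = mult (star x) a)"

definition skew_star_element ::
    "('a::ab_group_add \<Rightarrow> 'a \<Rightarrow> 'a) \<Rightarrow> ('a \<Rightarrow> 'a) \<Rightarrow> 'a \<Rightarrow> bool" where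
  "skew_star_element mult star a \<longleftrightarrow> skew star a \<and> star_element mult star a"

abbreviation cay_scale ::
    "('k::comm_ring_1 \<Rightarrow> 'a::ab_group_add \<Rightarrow> 'a) \<Rightarrow> 'k \<Rightarrow> 'a \<times> 'a \<Rightarrow> 'a \<times> 'a" where
  "cay_scale smul \<equiv> module_prod.scale smul smul"

definition cay_mult ::
    "('k::comm_ring_1 \<Rightarrow> 'a::ab_group_add \<Rightarrow> 'a) \<Rightarrow> ('a \<Rightarrow> 'a \<Rightarrow> 'a) \<Rightarrow> ('a \<Rightarrow> 'a) \<Rightarrow> 'k \<Rightarrow>
      'a \<times> 'a \<Rightarrow> 'a \<times> 'a \<Rightarrow> 'a \<times> 'a" where
  "cay_mult smul mult star \<mu> = (\<lambda>(u, v) (x, y).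
     (mult u x + smul \<mu> (mult (star y) v), mult v (star x) + mult y u))"

definition cay_one :: "'a::ab_group_add \<Rightarrow> 'a \<times> 'a" where
  "cay_one one = (one, 0)"

lemma (in star_algebra) star_one: "star \<one> = \<one>"
  by (metis mult_one_left mult_one_right star_mult star_star)

lemma (in star_algebra) cayley_double_algebra:
  "nonassoc_algebra (cay_scale smul) (cay_mult smul mult star \<mu>) (cay_one one)"
proof -
  interpret P: module_prod smul smul by unfold_locales
  have mult_zero: "0 \<odot> x = 0" "x \<odot> 0 = 0" for x
    using mult_add_left[of 0 0 x] mult_add_right[of x 0 0] by simp_all
  show ?thesis
    by unfold_locales
      (auto simp: P.scale_def cay_mult_def cay_one_def split_beta prod_eq_iff star_one mult_zero
        mult_add_left mult_add_right mult_scale_left mult_scale_right mult_one_left mult_one_right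
        star.add star.scale scale_right_distrib scale_left_distrib mult.commute)
qed

definition algebra_iso ::
    "('k::comm_ring_1 \<Rightarrow> 'a::ab_group_add \<Rightarrow> 'a) \<Rightarrow> ('a \<Rightarrow> 'a \<Rightarrow> 'a) \<Rightarrow> 'a \<Rightarrow>
     ('k \<Rightarrow> 'b::ab_group_add \<Rightarrow> 'b) \<Rightarrow> ('b \<Rightarrow> 'b \<Rightarrow> 'b) \<Rightarrow> 'b \<Rightarrow> ('a \<Rightarrow> 'b) \<Rightarrow> bool" where
  "algebra_iso scale1 mult1 one1 scale2 mult2 one2 \<phi> \<longleftrightarrow>
     module_hom scale1 scale2 \<phi> \<and> bij \<phi> \<and>
     (\<forall>p q. \<phi> (mult1 p q) = mult2 (\<phi> p) (\<phi> q)) \<and> \<phi> one1 = one2"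

definition cay_A_isomorphism ::
    "('k::comm_ring_1 \<Rightarrow> 'a::ab_group_add \<Rightarrow> 'a) \<Rightarrow> ('a \<Rightarrow> 'a \<Rightarrow> 'a) \<Rightarrow> 'a \<Rightarrow> ('a \<Rightarrow> 'a) \<Rightarrow>
     'k \<Rightarrow> 'k \<Rightarrow> ('a \<times> 'a \<Rightarrow> 'a \<times> 'a) \<Rightarrow> bool" where
  "cay_A_isomorphism smul mult one star \<mu>1 \<mu>2 \<phi> \<longleftrightarrow>
     algebra_iso
       (cay_scale smul) (cay_mult smul mult star \<mu>1) (cay_one one)
       (cay_scale smul) (cay_mult smul mult star \<mu>2) (cay_one one) \<phi> \<and>
     (\<forall>x. \<phi> (x, 0) = (x, 0))"

end

theory Submission
  imports Defs
begin

text \<open>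
  Put \<open>j = (0, \<one>)\<close>. In a Cayley double, \<open>(0, y)\<close> is both \<open>(y, 0) j\<close> and \<open>j (star y, 0)\<close>, so an
  \<open>A\<close>-isomorphism is determined by \<open>\<phi> j = (c, d)\<close> and has to be
  \<open>(x, y) \<mapsto> (x + c \<odot> star y, d \<odot> y)\<close>. Such a triangular map is bijective exactly when left
  multiplication by \<open>d\<close> is, which leaves the question of when it is multiplicative.

  Since it is additive and fixes \<open>A\<close>, it suffices to multiply elements of \<open>(A, 0)\<close> and \<open>(0, A)\<close> with
  each other; comparing components gives the five identities of lemma \<open>cay_map_mult_iff\<close>.
  One of them says \<open>d\<close> is in the left nucleus and two others express \<open>c \<odot> (x \<odot> y)\<close> as
  \<open>star x \<odot> (c \<odot> y)\<close> and as \<open>(c \<odot> y) \<odot> x\<close>. The key is that \<open>c\<close> kills commutators: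
  \<open>c \<odot> (x \<odot> y) = c \<odot> (y \<odot> x)\<close>. With this, the order of the factors in those two identities can be
  interchanged, and they become exactly the statement that \<open>c\<close> is a nuclear \<open>*\<close>-element.
  In one direction commutators are killed because of the second component of
  \<open>\<phi> (0, v) \<phi> (0, y) = \<phi> ((0, v) (0, y))\<close>, from which \<open>d\<close> can be cancelled; it also
  yields that \<open>c\<close> is skew. In the other direction it is a property of every \<open>*\<close>-element of the nucleus.
\<close>

context star_algebra
begin

definition cay_map :: "'a \<Rightarrow> 'a \<Rightarrow> 'a \<times> 'a \<Rightarrow> 'a \<times> 'a" where
  "cay_map c d = (\<lambda>(x, y). (x + c \<odot> star y, d \<odot> y))"

lemma mult_zero_left [simp]: "0 \<odot> x = 0"
  using mult_add_left[of 0 0 x] by simp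

lemma mult_zero_right [simp]: "x \<odot> 0 = 0"
  using mult_add_right[of x 0 0] by simp

lemma mult_minus_right: "x \<odot> (- y) = - (x \<odot> y)"
  by (metis add.right_inverse minus_unique mult_add_right mult_zero_right)

lemma nucleus_iff:
  "c \<in> nucleus mult \<longleftrightarrow>
     (\<forall>x y. (c \<odot> x) \<odot> y = c \<odot> (x \<odot> y)) \<and>
     (\<forall>x y. (x \<odot> c) \<odot> y = x \<odot> (c \<odot> y)) \<and>
     (\<forall>x y. (x \<odot> y) \<odot> c = x \<odot> (y \<odot> c))"
  by (auto simp: nucleus_def left_nucleus_def middle_nucleus_def right_nucleus_def associator_def)

lemma left_nucleus_iff: "d \<in> left_nucleus mult \<longleftrightarrow> (\<forall>x y. (d \<odot> x) \<odot> y = d \<odot> (x \<odot> y))"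
  by (auto simp: left_nucleus_def associator_def)

lemma cay_mult_apply:
  "cay_mult smul mult star \<mu> (u, v) (x, y) =
     (u \<odot> x + \<mu> *s (star y \<odot> v), v \<odot> star x + y \<odot> u)"
  by (simp add: cay_mult_def)

text \<open>
  Moving \<open>c\<close> past a factor stars that factor, and moving it past a product reverses the product.
  Passing \<open>c\<close> through \<open>x \<odot> y\<close> as a whole and then back one factor at a time therefore leaves
  the factors in the opposite order.
\<close>

lemma nuclear_star_element_kills_commutators:
  assumes "c \<in> nucleus mult" and "star_element mult star c"
  shows "c \<odot> (x \<odot> y) = c \<odot> (y \<odot> x)"
proof -
  have N: "(c \<odot> x) \<odot> y = c \<odot> (x \<odot> y)" "(x \<odot> c) \<odot> y = x \<odot> (c \<odot> y)"
    "(x \<odot> y) \<odot> c = x \<odot> (y \<odot> c)" for x y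
    using assms(1) by (auto simp: nucleus_iff)
  have S: "c \<odot> x = star x \<odot> c" for x
    using assms(2) by (auto simp: star_element_def)
  have "c \<odot> (x \<odot> y) = (star y \<odot> star x) \<odot> c"
    by (simp add: S star_mult)
  also have "\<dots> = star y \<odot> (c \<odot> x)"
    by (simp only: N(3) S)
  also have "\<dots> = (c \<odot> y) \<odot> x"
    by (simp only: N(2)[symmetric] S[of y])
  finally show ?thesis
    by (simp add: N)
qed

text \<open>
  The first identity is the second component of \<open>(x, 0) (0, y)\<close>, whose first component is the
  second identity; the third identity belongs to \<open>(0, y) (x, 0)\<close>, and the last two are the
  components of \<open>(0, v) (0, y)\<close>. Elements of \<open>A\<close> have been replaced by their images under \<open>star\<close>
  where this removes a star.
\<close>

lemma cay_map_mult_iff: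
  "(\<forall>p q. cay_map c d (cay_mult smul mult star \<mu>1 p q) =
          cay_mult smul mult star \<mu>2 (cay_map c d p) (cay_map c d q)) \<longleftrightarrow>
     (\<forall>x y. (d \<odot> y) \<odot> x = d \<odot> (y \<odot> x)) \<and>
     (\<forall>x y. star x \<odot> (c \<odot> y) = c \<odot> (x \<odot> y)) \<and>
     (\<forall>x y. (c \<odot> y) \<odot> x = c \<odot> (x \<odot> y)) \<and>
     (\<forall>x v. \<mu>1 *s (x \<odot> v) = (c \<odot> star v) \<odot> (c \<odot> x) + \<mu>2 *s ((x \<odot> star d) \<odot> (d \<odot> v))) \<and>
     (\<forall>v y. (d \<odot> v) \<odot> (y \<odot> star c) + (d \<odot> y) \<odot> (c \<odot> star v) = 0)"
  (is "?hom \<longleftrightarrow> ?D \<and> ?Q \<and> ?P \<and> ?M \<and> ?O")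
proof
  assume hom: ?hom
  have UY: "c \<odot> (star u \<odot> star y) = u \<odot> (c \<odot> star y)" "d \<odot> (y \<odot> u) = (d \<odot> y) \<odot> u" for u y
    using hom[rule_format, of "(u, 0)" "(0, y)"]
    by (simp_all add: cay_map_def cay_mult_apply star_mult star.zero)
  have VX: "c \<odot> (x \<odot> star v) = (c \<odot> star v) \<odot> x" for x v
    using hom[rule_format, of "(0, v)" "(x, 0)"]
    by (simp add: cay_map_def cay_mult_apply star_mult star_star star.zero)
  have VY:
    "\<mu>1 *s (star y \<odot> v) = (c \<odot> star v) \<odot> (c \<odot> star y) + \<mu>2 *s ((star y \<odot> star d) \<odot> (d \<odot> v))"
    "(d \<odot> v) \<odot> (y \<odot> star c) + (d \<odot> y) \<odot> (c \<odot> star v) = 0" for v y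
    using hom[rule_format, of "(0, v)" "(0, y)"]
    by (simp_all add: cay_map_def cay_mult_apply star_mult star_star star.zero)
  have ?Q
    by (metis UY(1) star_star)
  moreover have ?P
    by (metis VX star_star)
  moreover have ?M
    by (metis VY(1) star_star)
  ultimately show "?D \<and> ?Q \<and> ?P \<and> ?M \<and> ?O"
    using UY(2) VY(2) by simp
next
  assume R: "?D \<and> ?Q \<and> ?P \<and> ?M \<and> ?O"
  then have Q: "c \<odot> (star u \<odot> y) = u \<odot> (c \<odot> y)" for u y
    by (metis star_star)
  show ?hom
  proof (clarify, goal_cases)
    case (1 u v x y)
    have M: "\<mu>1 *s (star y \<odot> v) =
        (c \<odot> star v) \<odot> (c \<odot> star y) + \<mu>2 *s ((star y \<odot> star d) \<odot> (d \<odot> v))"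
      using R by blast
    have O: "(d \<odot> v) \<odot> (y \<odot> star c) + (d \<odot> y) \<odot> (c \<odot> star v) = 0"
      using R by blast
    have D: "d \<odot> (y \<odot> x) = (d \<odot> y) \<odot> x" and P: "c \<odot> (x \<odot> y) = (c \<odot> y) \<odot> x" for x y
      using R by auto
    have "d \<odot> (v \<odot> star x + y \<odot> u) = (d \<odot> v) \<odot> (star x + y \<odot> star c) + (d \<odot> y) \<odot> (u + c \<odot> star v)"
      using O by (simp add: mult_add_right D add_ac)
    moreover have "u \<odot> x + \<mu>1 *s (star y \<odot> v) + c \<odot> (x \<odot> star v + star u \<odot> star y) =
        (u + c \<odot> star v) \<odot> (x + c \<odot> star y) + \<mu>2 *s ((star y \<odot> star d) \<odot> (d \<odot> v))"
      by (simp add: M mult_add_right mult_add_left Q P[of x] add_ac)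
    ultimately show ?case
      by (simp add: cay_map_def cay_mult_apply star_mult star_star star.add)
  qed
qed

text \<open>
  From multiplicativity to the conditions on \<open>c\<close>: the second identity of \<open>cay_map_mult_iff\<close> at
  \<open>y = \<one>\<close> is the \<open>*\<close>-element property, and the last one at \<open>v = y = \<one>\<close> is skewness. Then the last
  one reads \<open>d \<odot> (v \<odot> (y \<odot> c)) = d \<odot> (y \<odot> (v \<odot> c))\<close>, and cancelling \<open>d\<close> gives the
  commutation of factors next to \<open>c\<close> on which both the nuclear property and the form \<open>c \<odot> c\<close> of
  the coefficient rest.
\<close>

lemma cay_map_mult_iff_nuclear:
  assumes inj: "inj (\<lambda>x. d \<odot> x)"
  shows "(\<forall>p q. cay_map c d (cay_mult smul mult star \<mu>1 p q) =
                cay_mult smul mult star \<mu>2 (cay_map c d p) (cay_map c d q)) \<longleftrightarrow>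
    c \<in> nucleus mult \<and> skew_star_element mult star c \<and> d \<in> left_nucleus mult \<and>
    (\<forall>x y. \<mu>1 *s (x \<odot> y) = (c \<odot> c) \<odot> (x \<odot> y) + \<mu>2 *s ((x \<odot> star d) \<odot> (d \<odot> y)))"
  (is "?hom \<longleftrightarrow> ?R")
proof
  assume ?hom
  then have D: "(d \<odot> y) \<odot> x = d \<odot> (y \<odot> x)"
    and Q: "star x \<odot> (c \<odot> y) = c \<odot> (x \<odot> y)"
    and P: "(c \<odot> y) \<odot> x = c \<odot> (x \<odot> y)"
    and M: "\<mu>1 *s (x \<odot> v) = (c \<odot> star v) \<odot> (c \<odot> x) + \<mu>2 *s ((x \<odot> star d) \<odot> (d \<odot> v))"
    and O: "(d \<odot> v) \<odot> (y \<odot> star c) + (d \<odot> y) \<odot> (c \<odot> star v) = 0" for x y v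
    unfolding cay_map_mult_iff by blast+
  have S: "c \<odot> x = star x \<odot> c" for x
    using Q[of x \<one>] by (simp add: mult_one_right)
  have cancel: "x = y" if "d \<odot> x = d \<odot> y" for x y
    using inj that by (auto dest: injD)
  have "d \<odot> (star c + c) = d \<odot> 0"
    using O[of \<one> \<one>] by (simp add: mult_one_left mult_one_right star_one mult_add_right)
  then have skew: "star c = - c"
    unfolding eq_neg_iff_add_eq_0 by (rule cancel)
  have swap: "v \<odot> (y \<odot> c) = y \<odot> (v \<odot> c)" for v y
  proof (rule cancel)
    have "(d \<odot> v) \<odot> (y \<odot> c) = (d \<odot> y) \<odot> (c \<odot> star v)"
      using O[of v y] by (simp add: skew mult_minus_right)
    then show "d \<odot> (v \<odot> (y \<odot> c)) = d \<odot> (y \<odot> (v \<odot> c))"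
      by (simp add: D S star_star)
  qed
  have comm: "c \<odot> (x \<odot> y) = c \<odot> (y \<odot> x)" for x y
    by (metis Q S swap)
  have left: "(c \<odot> x) \<odot> y = c \<odot> (x \<odot> y)" for x y
    using P comm by metis
  moreover have "(x \<odot> c) \<odot> y = x \<odot> (c \<odot> y)" for x y
    by (metis Q S left star_star)
  moreover have "(x \<odot> y) \<odot> c = x \<odot> (y \<odot> c)" for x y
    by (metis Q S comm star_mult star_star)
  ultimately have "c \<in> nucleus mult"
    by (simp add: nucleus_iff)
  moreover have "(c \<odot> star v) \<odot> (c \<odot> x) = (c \<odot> c) \<odot> (x \<odot> v)" for x v
    by (metis Q S comm left star_star)
  ultimately show ?R
    using M D S skew
    by (simp add: left_nucleus_iff skew_star_element_def skew_def star_element_def)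
next
  assume R: ?R
  then have N: "(c \<odot> x) \<odot> y = c \<odot> (x \<odot> y)" "(x \<odot> c) \<odot> y = x \<odot> (c \<odot> y)"
    "(x \<odot> y) \<odot> c = x \<odot> (y \<odot> c)" for x y
    by (auto simp: nucleus_iff)
  from R have S: "c \<odot> x = star x \<odot> c" and skew: "star c = - c"
    and D: "(d \<odot> x) \<odot> y = d \<odot> (x \<odot> y)"
    and M: "\<mu>1 *s (x \<odot> y) = (c \<odot> c) \<odot> (x \<odot> y) + \<mu>2 *s ((x \<odot> star d) \<odot> (d \<odot> y))" for x y
    by (auto simp: skew_star_element_def skew_def star_element_def left_nucleus_iff)
  have comm: "c \<odot> (x \<odot> y) = c \<odot> (y \<odot> x)" for x y
    using R nuclear_star_element_kills_commutators by (auto simp: skew_star_element_def)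
  have Q: "star x \<odot> (c \<odot> y) = c \<odot> (x \<odot> y)" for x y
    by (metis N(1,2) S)
  have P: "(c \<odot> y) \<odot> x = c \<odot> (x \<odot> y)" for x y
    using N(1) comm by metis
  have CC: "(c \<odot> star v) \<odot> (c \<odot> x) = (c \<odot> c) \<odot> (x \<odot> v)" for x v
    by (metis N(1) Q comm star_star)
  have "v \<odot> (y \<odot> c) = y \<odot> (c \<odot> star v)" for v y
    by (metis N(3) S comm star_mult star_star)
  then have "(d \<odot> v) \<odot> (y \<odot> c) = (d \<odot> y) \<odot> (c \<odot> star v)" for v y
    by (metis D)
  then have "(d \<odot> v) \<odot> (y \<odot> star c) + (d \<odot> y) \<odot> (c \<odot> star v) = 0" for v y
    by (simp add: skew mult_minus_right)
  then show ?hom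
    unfolding cay_map_mult_iff using D Q P M CC by simp
qed

text \<open>The map is a shear followed by left multiplication by \<open>d\<close> on the second component.\<close>

lemma bij_cay_map_iff: "bij (cay_map c d) \<longleftrightarrow> bij (\<lambda>x. d \<odot> x)"
proof
  assume bij: "bij (cay_map c d)"
  have "y = z" if "d \<odot> y = d \<odot> z" for y z
  proof -
    have "cay_map c d (- (c \<odot> star y), y) = cay_map c d (- (c \<odot> star z), z)"
      using that by (simp add: cay_map_def)
    then show ?thesis
      using bij by (auto dest!: bij_is_inj injD)
  qed
  moreover have "\<exists>x. w = d \<odot> x" for w
    using bij_is_surj[OF bij] by (auto simp: cay_map_def dest!: surjD[where y = "(0, w)"])
  ultimately show "bij (\<lambda>x. d \<odot> x)"
    by (simp add: bij_def inj_def surj_def)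
next
  assume bij: "bij (\<lambda>x. d \<odot> x)"
  then have "d \<odot> y = d \<odot> z \<longleftrightarrow> y = z" for y z
    by (auto dest: bij_is_inj injD)
  then have "inj (cay_map c d)"
    by (auto simp: cay_map_def inj_def)
  moreover have "\<exists>p. w = cay_map c d p" for w
  proof -
    obtain y where "snd w = d \<odot> y"
      using bij by (meson bij_is_surj surjD)
    then show ?thesis
      by (intro exI[of _ "(fst w - c \<odot> star y, y)"]) (simp add: cay_map_def prod_eq_iff)
  qed
  ultimately show "bij (cay_map c d)"
    by (simp add: bij_def surj_def)
qed

lemma cay_map_linear: "module_hom (cay_scale smul) (cay_scale smul) (cay_map c d)"
proof -
  interpret P: module_prod smul smul by unfold_locales
  show ?thesis
    by unfold_locales
      (auto simp: P.scale_def cay_map_def mult_add_right mult_scale_right star.add star.scale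
        scale_right_distrib scale_left_distrib)
qed

text \<open>
  Here \<open>(c, d)\<close> is the image of \<open>(0, \<one>)\<close>: since \<open>(0, y) = (0, \<one>) (star y, 0)\<close>
  and \<open>(star y, 0)\<close> is fixed, it determines the image of every \<open>(0, y)\<close>.
\<close>

lemma cay_A_isomorphism_imp_cay_map:
  assumes "cay_A_isomorphism smul mult \<one> star \<mu>1 \<mu>2 \<phi>"
  shows "\<exists>c d. \<phi> = cay_map c d"
proof -
  interpret \<phi>: module_hom "cay_scale smul" "cay_scale smul" \<phi>
    using assms by (simp add: cay_A_isomorphism_def algebra_iso_def)
  have hom: "\<phi> (cay_mult smul mult star \<mu>1 p q) = cay_mult smul mult star \<mu>2 (\<phi> p) (\<phi> q)"
    and fixes_A: "\<phi> (x, 0) = (x, 0)" for p q x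
    using assms unfolding cay_A_isomorphism_def algebra_iso_def by blast+
  obtain c d where cd: "\<phi> (0, \<one>) = (c, d)"
    by fastforce
  have "\<phi> (0, y) = (c \<odot> star y, d \<odot> y)" for y
    using hom[of "(0, \<one>)" "(star y, 0)"]
    by (simp add: cd fixes_A cay_mult_apply star.zero star_star mult_one_left)
  then have "\<phi> (x, y) = (x + c \<odot> star y, d \<odot> y)" for x y
    using \<phi>.add[of "(x, 0)" "(0, y)"] by (simp add: fixes_A)
  then have "\<phi> = cay_map c d"
    by (auto simp: cay_map_def)
  then show ?thesis
    by blast
qed

lemma cay_A_isomorphism_cay_map_iff:
  "cay_A_isomorphism smul mult \<one> star \<mu>1 \<mu>2 (cay_map c d) \<longleftrightarrow>
    c \<in> nucleus mult \<and> skew_star_element mult star c \<and>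
    d \<in> left_nucleus mult \<and> bij (\<lambda>x. d \<odot> x) \<and>
    (\<forall>x y. \<mu>1 *s (x \<odot> y) = (c \<odot> c) \<odot> (x \<odot> y) + \<mu>2 *s ((x \<odot> star d) \<odot> (d \<odot> y)))"
proof -
  have "cay_map c d (x, 0) = (x, 0)" for x
    by (simp add: cay_map_def star.zero)
  then have "cay_A_isomorphism smul mult \<one> star \<mu>1 \<mu>2 (cay_map c d) \<longleftrightarrow>
      bij (\<lambda>x. d \<odot> x) \<and>
      (\<forall>p q. cay_map c d (cay_mult smul mult star \<mu>1 p q) =
             cay_mult smul mult star \<mu>2 (cay_map c d p) (cay_map c d q))"
    by (simp add: cay_A_isomorphism_def algebra_iso_def cay_map_linear bij_cay_map_iff cay_one_def)
  then show ?thesis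
    using cay_map_mult_iff_nuclear[OF bij_is_inj, of d] by blast
qed

end

theorem theorem2:
  fixes smul :: "'k::comm_ring_1 \<Rightarrow> 'a::ab_group_add \<Rightarrow> 'a" (infixr "*s" 75)
    and mult :: "'a \<Rightarrow> 'a \<Rightarrow> 'a" (infixl "\<odot>" 70)
    and one :: 'a
    and star :: "'a \<Rightarrow> 'a"
    and \<mu>1 \<mu>2 :: 'k
    and \<phi> :: "'a \<times> 'a \<Rightarrow> 'a \<times> 'a"
  assumes "star_algebra smul mult one star"
    and "\<mu>1 \<noteq> 0" and "\<mu>2 \<noteq> 0"
  shows "cay_A_isomorphism smul mult one star \<mu>1 \<mu>2 \<phi> \<longleftrightarrow>
    (\<exists>c d. (\<forall>x y. \<phi> (x, y) = (x + c \<odot> star y, d \<odot> y)) \<and>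
      c \<in> nucleus mult \<and> skew_star_element mult star c \<and>
      d \<in> left_nucleus mult \<and> bij (\<lambda>x. d \<odot> x) \<and>
      (\<forall>x y. \<mu>1 *s (x \<odot> y) = (c \<odot> c) \<odot> (x \<odot> y) + \<mu>2 *s ((x \<odot> star d) \<odot> (d \<odot> y))))"
proof -
  interpret star_algebra smul mult one star by fact
  have form: "(\<forall>x y. \<phi> (x, y) = (x + c \<odot> star y, d \<odot> y)) \<longleftrightarrow> \<phi> = cay_map c d" for c d
    by (auto simp: cay_map_def fun_eq_iff)
  show ?thesis
    unfolding form
    using cay_A_isomorphism_imp_cay_map cay_A_isomorphism_cay_map_iff by metis
qed

end
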